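(* Let $\mathcal{I}$ be an instance of Weighted $k$-Server on the uniform metric with $k_j$ servers of weight $W_j$ for all $j\in[\ell]$. There is a randomized (polynomial-time) online algorithm for $\mathcal{I}$ that uses at most $2\ell k_j$ servers of weight $W_j$ for each $j\in[\ell]$ and has expected server movement cost at most $O(\ell^2\log\ell)$ times the optimal cost of $\mathcal{I}$.
   Context: Weighted $k$-Server on the uniform metric: there is a set of $n$ points $V=\{1,\dots,n\}$ with $d(v,v')=1$ for all $v\neq v'$, and $k$ servers, server $i$ having weight $w_i\ge 0$; the distinct weights are $W_1,\dots,W_\ell$ with $k_j$ servers of weight $W_j$. A request sequence $\sigma_1,\dots,\sigma_T\in V$ is given; in the online setting the requests are revealed one at a time and, upon the arrival of $\sigma_t$, the algorithm must (irrevocably) move servers so that some server is at $\sigma_t$ before seeing future requests. Starting from given initial positions, the cost of a solution is $\frac12\sum_i w_i\cdot(\text{number of times server } i \text{ changes location})$. The optimal cost of $\mathcal{I}$ is the minimum cost of an offline solution (knowing the whole sequence) using exactly the given $k_j$ servers of each weight $W_j$. *)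

theory Defs
  imports
    "HOL-Probability.Probability_Mass_Function"
    "HOL-Library.Landau_Symbols"
    "HOL-Computational_Algebra.Polynomial"
begin

section \<open>Weighted k-server on the uniform metric\<close>

text \<open>
  An instance without its request sequence. Points are \<open>1, \<dots>, npts\<close>; weight classes are
  \<open>1, \<dots>, nclasses\<close>; class \<open>j\<close> consists of the servers \<open>(j, 1), \<dots>, (j, cnt j)\<close>, all of weight
  \<open>wt j\<close>; server \<open>(j, i)\<close> starts at the point \<open>start j i\<close>.
\<close>

record wks =
  npts :: nat
  nclasses :: nat
  cnt :: "nat \<Rightarrow> nat"
  wt :: "nat \<Rightarrow> real"
  start :: "nat \<Rightarrow> nat \<Rightarrow> nat"

definition points :: "wks \<Rightarrow> nat set" where
  "points I = {1..npts I}"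

definition wks_instance :: "wks \<Rightarrow> bool" where
  "wks_instance I \<longleftrightarrow>
     1 \<le> npts I \<and> 1 \<le> nclasses I \<and>
     (\<forall>j\<in>{1..nclasses I}. 1 \<le> cnt I j \<and> 0 \<le> wt I j) \<and>
     inj_on (wt I) {1..nclasses I} \<and>
     (\<forall>j\<in>{1..nclasses I}. \<forall>i\<in>{1..cnt I j}. start I j i \<in> points I)"

type_synonym config = "nat \<Rightarrow> nat \<Rightarrow> nat"

text \<open>
  In the following, \<open>\<kappa> j\<close> is the number of servers of weight \<open>wt I j\<close> that are available. It is
  \<open>cnt I j\<close> for the offline optimum and larger for an algorithm with resource augmentation.
\<close>

definition placed :: "wks \<Rightarrow> (nat \<Rightarrow> nat) \<Rightarrow> config \<Rightarrow> bool" where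
  "placed I \<kappa> c \<longleftrightarrow> (\<forall>j\<in>{1..nclasses I}. \<forall>i\<in>{1..\<kappa> j}. c j i \<in> points I)"

definition covers :: "wks \<Rightarrow> (nat \<Rightarrow> nat) \<Rightarrow> nat \<Rightarrow> config \<Rightarrow> bool" where
  "covers I \<kappa> r c \<longleftrightarrow> (\<exists>j\<in>{1..nclasses I}. \<exists>i\<in>{1..\<kappa> j}. c j i = r)"

text \<open>
  A schedule lists the configuration before the first request, followed by the configuration in
  which each request is served. The servers of the instance begin at their given positions; the
  position at which an additional server begins is not prescribed.
\<close>

definition schedule :: "wks \<Rightarrow> (nat \<Rightarrow> nat) \<Rightarrow> nat list \<Rightarrow> config list \<Rightarrow> bool" where
  "schedule I \<kappa> \<sigma> cs \<longleftrightarrow>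
     (\<exists>c0 ds. cs = c0 # ds \<and> placed I \<kappa> c0 \<and>
        (\<forall>j\<in>{1..nclasses I}. \<forall>i\<in>{1..cnt I j}. c0 j i = start I j i) \<and>
        list_all2 (\<lambda>r c. placed I \<kappa> c \<and> covers I \<kappa> r c) \<sigma> ds)"

definition move_cost :: "wks \<Rightarrow> (nat \<Rightarrow> nat) \<Rightarrow> config \<Rightarrow> config \<Rightarrow> real" where
  "move_cost I \<kappa> c c' =
     1 / 2 * (\<Sum>j = 1..nclasses I. \<Sum>i = 1..\<kappa> j. wt I j * (if c j i \<noteq> c' j i then 1 else 0))"

fun cost :: "wks \<Rightarrow> (nat \<Rightarrow> nat) \<Rightarrow> config list \<Rightarrow> real" where
  "cost I \<kappa> (c # c' # cs) = move_cost I \<kappa> c c' + cost I \<kappa> (c' # cs)"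
| "cost I \<kappa> _ = 0"

text \<open>
  The infimum is a minimum: the set of costs is nonempty for a valid instance with requests in
  \<open>points I\<close>, and finite.
\<close>

definition opt :: "wks \<Rightarrow> nat list \<Rightarrow> real" where
  "opt I \<sigma> = Inf {cost I (cnt I) cs | cs. schedule I (cnt I) \<sigma> cs}"


section \<open>Randomized polynomial-time computation\<close>

text \<open>
  Since weights are real numbers, running time is measured on a random access machine whose memory
  consists of named two-dimensional arrays of naturals and of reals, with indirect addressing and
  fair coin flips. Every instruction or test costs one step. The arithmetic is deliberately weak:
  naturals are only added and subtracted, reals are added, subtracted, compared, and multiplied or
  divided by naturals; the only constants are naturals. Hence on rational data the binary length
  of all numbers stays polynomial in the number of steps and in the length of the data, so that
  polynomial time in this model is not an artefact of unit-cost arithmetic.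
\<close>

record store =
  nats :: "string \<Rightarrow> nat \<Rightarrow> nat \<Rightarrow> nat"
  reals :: "string \<Rightarrow> nat \<Rightarrow> nat \<Rightarrow> real"

datatype nexp =
    NConst nat
  | NCell string nexp nexp
  | NAdd nexp nexp
  | NSub nexp nexp

datatype rexp =
    RNat nexp
  | RCell string nexp nexp
  | RAdd rexp rexp
  | RSub rexp rexp
  | RScale nexp rexp
  | RDiv rexp nexp

datatype bexp =
    NLess nexp nexp
  | RLess rexp rexp
  | BNot bexp
  | BAnd bexp bexp

datatype com =
    SKIP
  | NSet string nexp nexp nexp
  | RSet string nexp nexp rexp
  | Flip string
  | Seq com com
  | Cond bexp com com
  | While bexp com

primrec nval :: "store \<Rightarrow> nexp \<Rightarrow> nat" where
  "nval s (NConst m) = m"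
| "nval s (NCell x a b) = nats s x (nval s a) (nval s b)"
| "nval s (NAdd a b) = nval s a + nval s b"
| "nval s (NSub a b) = nval s a - nval s b"

primrec rval :: "store \<Rightarrow> rexp \<Rightarrow> real" where
  "rval s (RNat a) = real (nval s a)"
| "rval s (RCell x a b) = reals s x (nval s a) (nval s b)"
| "rval s (RAdd a b) = rval s a + rval s b"
| "rval s (RSub a b) = rval s a - rval s b"
| "rval s (RScale a b) = real (nval s a) * rval s b"
| "rval s (RDiv a b) = rval s a / real (nval s b)"

primrec bval :: "store \<Rightarrow> bexp \<Rightarrow> bool" where
  "bval s (NLess a b) \<longleftrightarrow> nval s a < nval s b"
| "bval s (RLess a b) \<longleftrightarrow> rval s a < rval s b"
| "bval s (BNot b) \<longleftrightarrow> \<not> bval s b"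
| "bval s (BAnd a b) \<longleftrightarrow> bval s a \<and> bval s b"

definition put_nat :: "string \<Rightarrow> nat \<Rightarrow> nat \<Rightarrow> nat \<Rightarrow> store \<Rightarrow> store" where
  "put_nat x i j v s = s\<lparr>nats := (nats s)(x := (nats s x)(i := (nats s x i)(j := v)))\<rparr>"

definition put_real :: "string \<Rightarrow> nat \<Rightarrow> nat \<Rightarrow> real \<Rightarrow> store \<Rightarrow> store" where
  "put_real x i j v s = s\<lparr>reals := (reals s)(x := (reals s x)(i := (reals s x i)(j := v)))\<rparr>"

text \<open>A command and a store form a machine state; the machine has halted iff the command is
  \<open>SKIP\<close>.\<close>

primrec step :: "com \<Rightarrow> store \<Rightarrow> (com \<times> store) pmf" where
  "step SKIP s = return_pmf (SKIP, s)"
| "step (NSet x a b e) s =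
     return_pmf (SKIP, put_nat x (nval s a) (nval s b) (nval s e) s)"
| "step (RSet x a b e) s =
     return_pmf (SKIP, put_real x (nval s a) (nval s b) (rval s e) s)"
| "step (Flip x) s =
     map_pmf (\<lambda>h. (SKIP, put_nat x 0 0 (if h then 1 else 0) s)) (bernoulli_pmf (1 / 2))"
| "step (Seq c d) s =
     (if c = SKIP then return_pmf (d, s)
      else map_pmf (\<lambda>(c', s'). (Seq c' d, s')) (step c s))"
| "step (Cond b c d) s = return_pmf (if bval s b then c else d, s)"
| "step (While b c) s = return_pmf (if bval s b then Seq c (While b c) else SKIP, s)"

primrec steps :: "nat \<Rightarrow> com \<times> store \<Rightarrow> (com \<times> store) pmf" where
  "steps 0 m = return_pmf m"
| "steps (Suc N) m = bind_pmf (step (fst m) (snd m)) (steps N)"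


section \<open>Online execution\<close>

text \<open>The number of points plus the number of servers.\<close>

definition inst_size :: "wks \<Rightarrow> nat" where
  "inst_size I = npts I + (\<Sum>j = 1..nclasses I. cnt I j)"

text \<open>The machine sees everything but the requests; its server positions are kept in \<open>pos\<close>, which
  initially holds the given positions.\<close>

definition load :: "wks \<Rightarrow> store" where
  "load I =
     \<lparr>nats = (\<lambda>_ _ _. 0)
        (''n'' := \<lambda>_ _. npts I,
         ''l'' := \<lambda>_ _. nclasses I,
         ''k'' := \<lambda>j _. if j \<in> {1..nclasses I} then cnt I j else 0,
         ''pos'' := \<lambda>j i. if j \<in> {1..nclasses I} \<and> i \<in> {1..cnt I j} then start I j i else 0),
      reals = (\<lambda>_ _ _. 0)
        (''W'' := \<lambda>j _. if j \<in> {1..nclasses I} then wt I j else 0)\<rparr>"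

definition config_of :: "com \<times> store \<Rightarrow> config" where
  "config_of m = nats (snd m) ''pos''"

text \<open>
  An online algorithm is a pair of programs. The first one runs once, before any request is known,
  and chooses the initial positions of the additional servers. The second one runs once per
  request, which it finds in \<open>req\<close>; later requests are not in memory, and the
  configuration is read off irrevocably when its time is over. The memory is kept between runs.

  The function \<open>B\<close> bounds the running time: the first program gets \<open>B 0\<close> steps, and the
  program serving the \<open>t\<close>-th request gets \<open>B t\<close> steps. Halted machines idle, so a
  smaller running time is harmless. The result is the random list of machine states at the end of
  these runs; it has finite support.
\<close>

type_synonym online_alg = "com \<times> com"

primrec serve :: "com \<Rightarrow> (nat \<Rightarrow> nat) \<Rightarrow> nat list \<Rightarrow> nat \<Rightarrow> store \<Rightarrow> (com \<times> store) list pmf" where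
  "serve c B [] t s = return_pmf []"
| "serve c B (r # \<sigma>) t s =
     bind_pmf (steps (B t) (c, put_nat ''req'' 0 0 r s))
       (\<lambda>m. map_pmf (Cons m) (serve c B \<sigma> (Suc t) (snd m)))"

definition play :: "online_alg \<Rightarrow> (nat \<Rightarrow> nat) \<Rightarrow> wks \<Rightarrow> nat list \<Rightarrow> (com \<times> store) list pmf" where
  "play A B I \<sigma> =
     bind_pmf (steps (B 0) (fst A, load I))
       (\<lambda>m. map_pmf (Cons m) (serve (snd A) B \<sigma> 1 (snd m)))"

definition all_halted :: "(com \<times> store) list \<Rightarrow> bool" where
  "all_halted ms \<longleftrightarrow> (\<forall>m\<in>set ms. fst m = SKIP)"

definition expected_cost ::
  "online_alg \<Rightarrow> (nat \<Rightarrow> nat) \<Rightarrow> wks \<Rightarrow> (nat \<Rightarrow> nat) \<Rightarrow> nat list \<Rightarrow> real" where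
  "expected_cost A B I \<kappa> \<sigma> =
     measure_pmf.expectation (play A B I \<sigma>) (\<lambda>ms. cost I \<kappa> (map config_of ms))"

end

theory Submission
  imports Defs "HOL-Real_Asymp.Real_Asymp"
begin

text \<open>
  A deterministic algorithm suffices, and it is even \<open>4\<ell>\<close>-competitive. Every class \<open>j\<close> keeps a
  credit \<open>c j v \<le> wt j\<close> for each point. When a request \<open>r\<close> hits no server, all credits of \<open>r\<close>
  grow by the same amount \<open>\<theta>\<close>, the least one for which some class \<open>a\<close> reaches \<open>c a r = wt a\<close>; that
  credit is reset and the oldest server of class \<open>a\<close> moves to \<open>r\<close>. An offline server of class \<open>j\<close>
  standing on \<open>v\<close> owes \<open>wt j - c j v\<close> or, if this is less and our class \<open>j\<close> occupies \<open>v\<close>, the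
  fraction of \<open>wt j\<close> given by the elapsed part of the time until \<open>v\<close> is evicted. A miss lowers the
  total debt by \<open>\<theta>\<close>, since some offline server stands on \<open>r\<close>, while the insertion ages the at most
  \<open>k\<^sub>a\<close> offline points of class \<open>a\<close>, which with \<open>2\<ell>k\<^sub>a\<close> servers raises the debt by at most
  \<open>3/(4\<ell>) wt a\<close>. The credits change by \<open>\<ell>\<theta> - wt a\<close> in total, so twice the sum of
  \<open>\<ell>\<close> times the debt and all credits drops by \<open>wt a / 2\<close>, the cost of the insertion; an offline
  move raises it by at most \<open>4\<ell>\<close> times its cost.
\<close>

section \<open>Timed total correctness\<close>

definition runs :: "com \<Rightarrow> nat \<Rightarrow> store \<Rightarrow> (store \<Rightarrow> bool) \<Rightarrow> bool" where
  "runs c T s Q \<longleftrightarrow> (\<forall>(c', s') \<in> set_pmf (steps T (c, s)). c' = SKIP \<and> Q s')"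

lemma steps_SKIP: "steps T (SKIP, s) = return_pmf (SKIP, s)"
  by (induction T) (simp_all add: bind_return_pmf)

lemma steps_add: "steps (T + T') = (\<lambda>m. bind_pmf (steps T m) (steps T'))"
proof (induction T)
  case (Suc T)
  then show ?case by (intro ext) (simp add: bind_assoc_pmf)
qed (simp add: bind_return_pmf)

lemma runs_SKIP [simp]: "runs SKIP T s Q \<longleftrightarrow> Q s"
  by (simp add: runs_def steps_SKIP)

lemma runs_0: "runs c 0 s Q \<longleftrightarrow> c = SKIP \<and> Q s"
  by (simp add: runs_def)

lemma runs_Suc: "runs c (Suc T) s Q \<longleftrightarrow> (\<forall>(c', s') \<in> set_pmf (step c s). runs c' T s' Q)"
  by (simp add: runs_def split_beta)

lemma runs_mono:
  assumes "runs c T s Q" "T \<le> T'" "\<And>s'. Q s' \<Longrightarrow> Q' s'"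
  shows "runs c T' s Q'"
proof -
  obtain d where "T' = T + d"
    using \<open>T \<le> T'\<close> le_Suc_ex by blast
  then show ?thesis
    using assms(1,3) by (force simp: runs_def steps_add steps_SKIP split_beta)
qed

lemma runs_Seq:
  assumes "runs c T s (\<lambda>s'. runs d T' s' Q)" "T + T' + 1 \<le> N"
  shows "runs (Seq c d) N s Q"
proof -
  have "runs (Seq c d) (Suc (T + T')) s Q"
    using assms(1)
  proof (induction T arbitrary: c s)
    case 0
    then show ?case by (simp add: runs_0 runs_Suc[of "Seq SKIP d"])
  next
    case (Suc T)
    show ?case
    proof (cases "c = SKIP")
      case True
      with Suc.prems have "runs d (Suc T + T') s Q"
        by (auto elim: runs_mono)
      with True show ?thesis by (simp add: runs_Suc[of "Seq SKIP d"])
    next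
      case False
      with Suc show ?thesis
        by (auto simp: runs_Suc[of "Seq c d"] runs_Suc[of c])
    qed
  qed
  then show ?thesis
    using assms(2) by (auto elim: runs_mono)
qed

lemma runs_Seq_trans:
  assumes "runs c T s R" "\<And>s'. R s' \<Longrightarrow> runs d T' s' Q" "T + T' + 1 \<le> N"
  shows "runs (Seq c d) N s Q"
  using runs_mono[OF assms(1) order_refl assms(2)] assms(3) by (rule runs_Seq)

abbreviation reg :: "store \<Rightarrow> string \<Rightarrow> nat" where
  "reg s x \<equiv> nats s x 0 0"

abbreviation register :: "string \<Rightarrow> nexp" where
  "register x \<equiv> NCell x (NConst 0) (NConst 0)"

abbreviation assign :: "string \<Rightarrow> nexp \<Rightarrow> com" where
  "assign x \<equiv> NSet x (NConst 0) (NConst 0)"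

abbreviation at_most :: "nexp \<Rightarrow> nexp \<Rightarrow> bexp" where
  "at_most a b \<equiv> BNot (NLess b a)"

abbreviation increment :: "string \<Rightarrow> com" where
  "increment x \<equiv> assign x (NAdd (register x) (NConst 1))"

definition For :: "string \<Rightarrow> nexp \<Rightarrow> nexp \<Rightarrow> com \<Rightarrow> com" where
  "For i a b c = Seq (assign i a)
     (While (at_most (register i) b) (Seq c (increment i)))"

lemma nats_put_nat [simp]:
  "nats (put_nat x i j v s) = (nats s)(x := (nats s x)(i := (nats s x i)(j := v)))"
  by (simp add: put_nat_def)

lemma reals_put_nat [simp]: "reals (put_nat x i j v s) = reals s"
  by (simp add: put_nat_def)

lemma reals_put_real [simp]:
  "reals (put_real x i j v s) = (reals s)(x := (reals s x)(i := (reals s x i)(j := v)))"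
  by (simp add: put_real_def)

lemma nats_put_real [simp]: "nats (put_real x i j v s) = nats s"
  by (simp add: put_real_def)

lemma runs_Seq_NSet:
  assumes "runs c T (put_nat x (nval s a) (nval s b) (nval s e) s) Q" "T + 2 \<le> T'"
  shows "runs (Seq (NSet x a b e) c) T' s Q"
  by (rule runs_Seq[where T = 1 and T' = T]) (use assms in \<open>simp_all add: runs_Suc\<close>)

lemma runs_Seq_RSet:
  assumes "runs c T (put_real x (nval s a) (nval s b) (rval s e) s) Q" "T + 2 \<le> T'"
  shows "runs (Seq (RSet x a b e) c) T' s Q"
  by (rule runs_Seq[where T = 1 and T' = T]) (use assms in \<open>simp_all add: runs_Suc\<close>)

context
  fixes Inv :: "nat \<Rightarrow> store \<Rightarrow> bool" and i :: string and b :: nexp and c :: com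
    and lo n T :: nat and Q :: "store \<Rightarrow> bool"
  assumes counter: "\<And>m s v. Inv m s \<Longrightarrow> Inv m (put_nat i 0 0 v s)"
    and limit: "\<And>m s. Inv m s \<Longrightarrow> nval s b = n"
    and body: "\<And>m s. lo \<le> m \<Longrightarrow> m \<le> n \<Longrightarrow> Inv m s \<Longrightarrow> reg s i = m \<Longrightarrow>
      runs c T s (\<lambda>s'. reg s' i = m \<and> Inv (Suc m) s')"
    and exit: "\<And>s. Inv (Suc n) s \<Longrightarrow> Q s"
begin

lemma runs_While_counting:
  assumes "lo \<le> m" "m \<le> Suc n" "Inv m s" "reg s i = m"
  shows "runs (While (at_most (register i) b) (Seq c (increment i)))
    ((Suc n - m) * (T + 4) + 1) s Q" (is "runs ?loop _ _ _")
  using assms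
proof (induction "Suc n - m" arbitrary: m s)
  case 0
  then have "m = Suc n" by simp
  with 0 limit exit show ?case by (simp add: runs_Suc)
next
  case (Suc d)
  then have "m \<le> n" "d = Suc n - Suc m" by auto
  let ?t = "(Suc n - Suc m) * (T + 4) + 1"
  have "runs c T s (\<lambda>s'. reg s' i = m \<and> Inv (Suc m) s')"
    using body Suc.prems \<open>m \<le> n\<close> by blast
  then have "runs (Seq c (increment i)) (T + 2) s (\<lambda>s'. runs ?loop ?t s' Q)"
  proof (rule runs_Seq_trans)
    fix s' assume "reg s' i = m \<and> Inv (Suc m) s'"
    then show "runs (increment i) 1 s' (\<lambda>s'. runs ?loop ?t s' Q)"
      using Suc.hyps(1)[OF \<open>d = _\<close>, of "put_nat i 0 0 (Suc m) s'"] Suc.prems \<open>m \<le> n\<close> counter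
      by (simp add: runs_Suc)
  qed simp
  then have "runs (Seq (Seq c (increment i)) ?loop) (T + 2 + ?t + 1) s Q"
    by (rule runs_Seq) simp
  then have "runs ?loop (Suc (T + 2 + ?t + 1)) s Q"
    using limit[of m s] Suc.prems \<open>m \<le> n\<close> by (subst runs_Suc) simp
  moreover have "Suc (T + 2 + ?t + 1) = (Suc n - m) * (T + 4) + 1"
    using \<open>m \<le> n\<close> by (simp add: Suc_diff_le)
  ultimately show ?case by simp
qed

lemma runs_For:
  assumes "nval s a = lo" "Inv lo s" "lo \<le> Suc n" "(Suc n - lo) * (T + 4) + 3 \<le> T'"
  shows "runs (For i a b c) T' s Q"
  unfolding For_def
proof (rule runs_Seq)
  show "runs (assign i a) 1 s
      (\<lambda>s'. runs (While (at_most (register i) b) (Seq c (increment i)))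
        ((Suc n - lo) * (T + 4) + 1) s' Q)"
    using runs_While_counting[of lo "put_nat i 0 0 lo s"] counter assms(1-3)
    by (simp add: runs_Suc)
qed (use assms(4) in simp)

end


section \<open>A single weight class\<close>

text \<open>
  The slots \<open>1, \<dots>, K\<close> are overwritten cyclically. Lifetimes only serve the analysis: slots that are
  filled by the algorithm live for \<open>K\<close> insertions, the initial occupant of slot \<open>s \<le> k\<close> only lives
  for \<open>K - k + s\<close>, and lifetime \<open>0\<close> marks a slot that still holds an arbitrary initial point.
\<close>

record 'v queue =
  occupant :: "nat \<Rightarrow> 'v"
  oldest :: nat
  credit :: "'v \<Rightarrow> real"
  lifetime :: "nat \<Rightarrow> nat"

definition admit :: "nat \<Rightarrow> 'v \<Rightarrow> 'v queue \<Rightarrow> 'v queue" where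
  "admit K v q =
     \<lparr>occupant = (occupant q)(oldest q := v),
      oldest = (if oldest q < K then oldest q + 1 else 1),
      credit = (credit q)(v := 0),
      lifetime = (lifetime q)(oldest q := K)\<rparr>"

definition charge :: "'v \<Rightarrow> real \<Rightarrow> 'v queue \<Rightarrow> 'v queue" where
  "charge v \<theta> q = q\<lparr>credit := (credit q)(v := credit q v + \<theta>)\<rparr>"

definition time_left :: "nat \<Rightarrow> 'v queue \<Rightarrow> nat \<Rightarrow> nat" where
  "time_left K q s = (if oldest q \<le> s then s - oldest q + 1 else K + s - oldest q + 1)"

definition valid_queue :: "real \<Rightarrow> nat \<Rightarrow> nat \<Rightarrow> 'v queue \<Rightarrow> bool" where
  "valid_queue w k K q \<longleftrightarrow> oldest q \<in> {1..K} \<and>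
     (\<forall>s\<in>{1..K}. lifetime q s = 0 \<or>
        time_left K q s \<le> lifetime q s \<and> K \<le> lifetime q s + (k - s)) \<and>
     (\<forall>v. 0 \<le> credit q v \<and> credit q v \<le> w)"

text \<open>A slot of lifetime \<open>0\<close> contributes nothing, since \<open>x / 0 = 0\<close>.\<close>

definition safety :: "real \<Rightarrow> nat \<Rightarrow> 'v queue \<Rightarrow> 'v \<Rightarrow> real" where
  "safety w K q v =
     Max (insert (credit q v)
       ((\<lambda>s. w * time_left K q s / lifetime q s) ` {s \<in> {1..K}. occupant q s = v}))"

definition debt :: "real \<Rightarrow> nat \<Rightarrow> 'v queue \<Rightarrow> 'v \<Rightarrow> real" where
  "debt w K q v = w - safety w K q v"

lemma admit_sel [simp]:
  "occupant (admit K v q) = (occupant q)(oldest q := v)"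
  "oldest (admit K v q) = (if oldest q < K then oldest q + 1 else 1)"
  "credit (admit K v q) = (credit q)(v := 0)"
  "lifetime (admit K v q) = (lifetime q)(oldest q := K)"
  by (simp_all add: admit_def)

lemma charge_sel [simp]:
  "occupant (charge v \<theta> q) = occupant q"
  "oldest (charge v \<theta> q) = oldest q"
  "credit (charge v \<theta> q) = (credit q)(v := credit q v + \<theta>)"
  "lifetime (charge v \<theta> q) = lifetime q"
  by (simp_all add: charge_def)

lemma admit_charge [simp]: "admit K v (charge v \<theta> q) = admit K v q"
  by (simp add: admit_def)

lemma time_left_charge [simp]: "time_left K (charge v \<theta> q) = time_left K q"
  by (simp add: time_left_def fun_eq_iff)

lemma time_left_oldest: "time_left K q (oldest q) = 1"
  by (simp add: time_left_def)

lemma time_left_admit_oldest: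
  "oldest q \<in> {1..K} \<Longrightarrow> time_left K (admit K v q) (oldest q) = K"
  by (auto simp: time_left_def)

lemma time_left_admit_other:
  "oldest q \<in> {1..K} \<Longrightarrow> s \<in> {1..K} \<Longrightarrow> s \<noteq> oldest q \<Longrightarrow>
    time_left K q s = Suc (time_left K (admit K v q) s)"
  by (auto simp: time_left_def)

lemma valid_queue_weight_nonneg: "valid_queue w k K q \<Longrightarrow> 0 \<le> w"
  unfolding valid_queue_def by (meson order_trans)

lemma valid_queue_admit:
  assumes "valid_queue w k K q"
  shows "valid_queue w k K (admit K v q)"
proof -
  have old: "oldest q \<in> {1..K}"
    using assms unfolding valid_queue_def by blast
  have "lifetime (admit K v q) s = 0 \<or> time_left K (admit K v q) s \<le> lifetime (admit K v q) s \<and>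
      K \<le> lifetime (admit K v q) s + (k - s)" if "s \<in> {1..K}" for s
  proof (cases "s = oldest q")
    case True
    then show ?thesis using time_left_admit_oldest[OF old] by simp
  next
    case False
    then show ?thesis
      using assms that time_left_admit_other[OF old that False, of v]
      unfolding valid_queue_def by force
  qed
  then show ?thesis
    using assms old valid_queue_weight_nonneg[OF assms] unfolding valid_queue_def by simp
qed

lemma valid_queue_charge:
  assumes "valid_queue w k K q" "0 \<le> \<theta>" "\<theta> \<le> w - credit q v"
  shows "valid_queue w k K (charge v \<theta> q)"
  using assms unfolding valid_queue_def by simp

lemma credit_le_safety: "credit q v \<le> safety w K q v"
  unfolding safety_def by (rule Max_ge) auto

lemma slot_le_safety:
  fixes w :: real
  shows "s \<in> {1..K} \<Longrightarrow> w * time_left K q s / lifetime q s \<le> safety w K q (occupant q s)"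
  unfolding safety_def by (rule Max_ge) auto

lemma safety_cases:
  fixes w :: real
  obtains (credit) "safety w K q v = credit q v"
  | (slot) s where "s \<in> {1..K}" "occupant q s = v"
      "safety w K q v = w * time_left K q s / lifetime q s"
proof -
  have "safety w K q v \<in> insert (credit q v)
      ((\<lambda>s. w * time_left K q s / lifetime q s) ` {s \<in> {1..K}. occupant q s = v})"
    unfolding safety_def by (rule Max_in) auto
  then show thesis using that by auto
qed

lemma safety_absent: "v \<notin> occupant q ` {1..K} \<Longrightarrow> safety w K q v = credit q v"
  using safety_cases[of w K q v] by (metis imageI)

lemma debt_nonneg:
  assumes "valid_queue w k K q"
  shows "0 \<le> debt w K q v"
proof (cases rule: safety_cases[of w K q v])
  case credit
  then show ?thesis using assms by (simp add: debt_def valid_queue_def)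
next
  case (slot s)
  have "real (time_left K q s) / lifetime q s \<le> 1"
    using assms slot(1) unfolding valid_queue_def by (force simp: divide_le_eq)
  then show ?thesis
    using slot(3) valid_queue_weight_nonneg[OF assms]
      mult_left_mono[of "real (time_left K q s) / lifetime q s" 1 w]
    by (simp add: debt_def)
qed

lemma debt_le_weight: "valid_queue w k K q \<Longrightarrow> debt w K q v \<le> w"
  using credit_le_safety[of q v w K] unfolding debt_def valid_queue_def by (smt (verit))

lemma debt_new_occupant:
  assumes "oldest q \<in> {1..K}"
  shows "debt w K (admit K v q) v \<le> 0"
  using slot_le_safety[of "oldest q" K w "admit K v q"] assms time_left_admit_oldest[OF assms, of v]
  by (simp add: debt_def)

lemma debt_admit_other:
  fixes w :: real
  assumes old: "oldest q \<in> {1..K}" and "0 \<le> credit q u" and "u \<noteq> v"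
    and growth: "debt w K q u < debt w K (admit K v q) u"
  obtains s where "s \<in> {1..K}" "occupant q s = u"
    "debt w K (admit K v q) u \<le> debt w K q u + w / lifetime q s"
proof (cases rule: safety_cases[of w K q u])
  case credit
  then show thesis
    using growth \<open>u \<noteq> v\<close> credit_le_safety[of "admit K v q" u w K] by (simp add: debt_def)
next
  case (slot s)
  have new: "credit q u \<le> safety w K (admit K v q) u"
    using credit_le_safety[of "admit K v q" u w K] \<open>u \<noteq> v\<close> by simp
  have "w * time_left K q s / lifetime q s \<le> safety w K (admit K v q) u + w / lifetime q s"
  proof (cases "s = oldest q")
    case True
    then show ?thesis
      using new \<open>0 \<le> credit q u\<close> by (simp add: time_left_oldest)
  next
    case False
    then have "w * time_left K (admit K v q) s / lifetime q s \<le> safety w K (admit K v q) u"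
      using slot_le_safety[of s K w "admit K v q"] slot by simp
    then show ?thesis
      using time_left_admit_other[OF old slot(1) False, of v]
      by (simp add: algebra_simps add_divide_distrib)
  qed
  with slot that show thesis by (simp add: debt_def)
qed

text \<open>
  The first term accounts for \<open>k\<close> slots of lifetime \<open>K\<close>, the second one for the shorter lifetimes of
  the initial occupants.
\<close>

definition ageing_rate :: "nat \<Rightarrow> nat \<Rightarrow> real" where
  "ageing_rate k K = real k / K + real k ^ 2 / (2 * real K * (real K - k))"

lemma ageing_rate_double:
  assumes "1 \<le> l" "1 \<le> k"
  shows "ageing_rate k (2 * l * k) \<le> 3 / (4 * real l)"
proof -
  have "real (2 * l * k) - real k = (2 * real l - 1) * real k"
    by (simp add: algebra_simps)
  then have "ageing_rate k (2 * l * k) = 1 / (2 * real l) + 1 / (4 * real l * (2 * real l - 1))"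
    using assms unfolding ageing_rate_def by (simp add: power2_eq_square)
  also have "\<dots> \<le> 1 / (2 * real l) + 1 / (4 * real l)"
    using assms by (intro add_left_mono divide_left_mono) auto
  also have "\<dots> = 3 / (4 * real l)"
    by (simp add: field_simps)
  finally show ?thesis .
qed

lemma inverse_lifetime_le:
  assumes valid: "valid_queue w k K q" and "k < K" "s \<in> {1..K}"
  shows "1 / real (lifetime q s) \<le> 1 / K + real (k - s) / (K * (real K - k))"
proof (cases "lifetime q s = 0")
  case False
  have le: "real K - real k \<le> real K - real (k - s)" and pos: "0 < real K - real k" "0 < real K"
    using \<open>k < K\<close> by simp_all
  have "real K - real (k - s) \<le> lifetime q s"
    using valid \<open>s \<in> {1..K}\<close> False unfolding valid_queue_def by force
  then have "1 / real (lifetime q s) \<le> 1 / (real K - real (k - s))"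
    using le pos by (intro divide_left_mono mult_pos_pos) auto
  also have "\<dots> = 1 / K + real (k - s) / (K * (real K - real (k - s)))"
    using le pos by (simp add: field_simps)
  also have "\<dots> \<le> 1 / K + real (k - s) / (K * (real K - k))"
    using le pos by (intro add_left_mono divide_left_mono mult_left_mono mult_pos_pos) auto
  finally show ?thesis .
qed (use \<open>k < K\<close> in auto)

lemma sum_truncated_diff_le:
  assumes "finite A" "0 \<notin> A"
  shows "(\<Sum>s\<in>A. real (k - s)) \<le> real k ^ 2 / 2"
proof -
  have "(\<Sum>s\<in>A. real (k - s)) = (\<Sum>s\<in>A \<inter> {1..k}. real (k - s))"
    using assms by (intro sum.mono_neutral_right) (auto simp: Suc_le_eq intro: gr0I)
  also have "\<dots> \<le> (\<Sum>s\<in>{1..k}. real (k - s))"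
    by (intro sum_mono2) auto
  also have "\<dots> = (\<Sum>s\<in>{1..k}. real k - real s)"
    by (intro sum.cong) auto
  also have "\<dots> = real k * real k - real k * (real k + 1) / 2"
    using double_gauss_sum_from_Suc_0[of k, where ?'a = real] by (simp add: sum_subtractf)
  also have "\<dots> \<le> real k ^ 2 / 2"
    by (simp add: field_simps power2_eq_square)
  finally show ?thesis .
qed

lemma sum_inverse_lifetimes:
  assumes valid: "valid_queue w k K q" and "k < K" and A: "A \<subseteq> {1..K}" "card A \<le> k"
  shows "(\<Sum>s\<in>A. 1 / real (lifetime q s)) \<le> ageing_rate k K"
proof -
  have "(\<Sum>s\<in>A. 1 / real (lifetime q s)) \<le> (\<Sum>s\<in>A. 1 / K + real (k - s) / (K * (real K - k)))"
    by (intro sum_mono inverse_lifetime_le[OF valid \<open>k < K\<close>]) (use A in auto)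
  also have "\<dots> = card A / K + (\<Sum>s\<in>A. real (k - s)) / (K * (real K - k))"
    by (simp add: sum.distrib sum_divide_distrib)
  also have "\<dots> \<le> real k / K + (real k ^ 2 / 2) / (K * (real K - k))"
    using A \<open>k < K\<close>
    by (intro add_mono divide_right_mono sum_truncated_diff_le) (auto intro: finite_subset)
  also have "\<dots> = ageing_rate k K"
    by (simp add: ageing_rate_def)
  finally show ?thesis .
qed

lemma sum_debt_admit_le:
  assumes valid: "valid_queue w k K q" and "k < K" and absent: "v \<notin> occupant q ` {1..K}"
    and S: "finite S" "card S \<le> k"
  shows "(\<Sum>u\<in>S. debt w K (admit K v q) u)
    \<le> (\<Sum>u\<in>S. debt w K q u) + w * ageing_rate k K - (if v \<in> S then w - credit q v else 0)"
proof -
  let ?old = "debt w K q" and ?new = "debt w K (admit K v q)"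
  have old: "oldest q \<in> {1..K}" and nonneg: "\<And>u. 0 \<le> credit q u"
    using valid unfolding valid_queue_def by blast+
  define D where "D = {u \<in> S - {v}. ?old u < ?new u}"
  have D: "D \<subseteq> S" "finite D" "card D \<le> k"
    using S card_mono[of S D] by (auto simp: D_def)
  have "\<exists>s. s \<in> {1..K} \<and> occupant q s = u \<and> ?new u \<le> ?old u + w / lifetime q s" if "u \<in> D" for u
    using that debt_admit_other[OF old nonneg, of u v w] unfolding D_def by blast
  then obtain slot where slot: "\<And>u. u \<in> D \<Longrightarrow>
      slot u \<in> {1..K} \<and> occupant q (slot u) = u \<and> ?new u \<le> ?old u + w / lifetime q (slot u)"
    by metis
  have "(\<Sum>u\<in>S. ?new u) \<le> (\<Sum>u\<in>S - {v}. ?new u)"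
    using S debt_new_occupant[OF old, of w v] by (cases "v \<in> S") (auto simp: sum.remove)
  also have "\<dots> \<le> (\<Sum>u\<in>S - {v}. ?old u + (if u \<in> D then w / lifetime q (slot u) else 0))"
    using slot by (intro sum_mono) (auto simp: D_def)
  also have "\<dots> = (\<Sum>u\<in>S - {v}. ?old u) + (\<Sum>u\<in>D. w / lifetime q (slot u))"
    using S by (auto simp: sum.distrib D_def intro!: sum.mono_neutral_cong_right split: if_splits)
  also have "(\<Sum>u\<in>D. w / lifetime q (slot u)) = w * (\<Sum>s\<in>slot ` D. 1 / lifetime q s)"
    using slot
    by (subst sum.reindex) (auto simp: sum_distrib_left intro: inj_on_inverseI[of _ "occupant q"])
  also have "\<dots> \<le> w * ageing_rate k K"
    using slot D card_image_le[of D slot] valid_queue_weight_nonneg[OF valid]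
    by (intro mult_left_mono sum_inverse_lifetimes[OF valid \<open>k < K\<close>]) auto
  also have "(\<Sum>u\<in>S - {v}. ?old u) = (\<Sum>u\<in>S. ?old u) - (if v \<in> S then w - credit q v else 0)"
    using S safety_absent[OF absent, of w] by (auto simp: sum_diff1 debt_def)
  finally show ?thesis by simp
qed

lemma sum_debt_charge:
  assumes absent: "v \<notin> occupant q ` {1..K}" and "finite S"
  shows "(\<Sum>u\<in>S. debt w K (charge v \<theta> q) u) = (\<Sum>u\<in>S. debt w K q u) - (if v \<in> S then \<theta> else 0)"
proof -
  have "debt w K (charge v \<theta> q) u = debt w K q u - (if u = v then \<theta> else 0)" for u
  proof (cases "u = v")
    case True
    then show ?thesis
      using absent safety_absent[of v q K w] safety_absent[of v "charge v \<theta> q" K w]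
      by (simp add: debt_def)
  qed (simp add: debt_def safety_def)
  then show ?thesis
    using \<open>finite S\<close> by (simp add: sum_subtractf)
qed


section \<open>The offline optimum\<close>

locale server_instance =
  fixes I :: wks
  assumes valid_instance: "wks_instance I"
begin

abbreviation classes :: "nat set" where
  "classes \<equiv> {1..nclasses I}"

definition slots :: "nat \<Rightarrow> nat" where
  "slots j = 2 * nclasses I * cnt I j"

lemma nclasses_pos: "1 \<le> nclasses I"
  using valid_instance unfolding wks_instance_def by blast

lemma cnt_pos: "j \<in> classes \<Longrightarrow> 1 \<le> cnt I j"
  using valid_instance unfolding wks_instance_def by blast

lemma wt_nonneg: "j \<in> classes \<Longrightarrow> 0 \<le> wt I j"
  using valid_instance unfolding wks_instance_def by blast

lemma cnt_less_slots: "j \<in> classes \<Longrightarrow> cnt I j < slots j"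
  using nclasses_pos cnt_pos[of j] unfolding slots_def by (cases "nclasses I") auto

lemma finite_points: "finite (points I)"
  by (simp add: points_def)

lemma move_cost_same: "move_cost I \<kappa> c c = 0"
  by (simp add: move_cost_def)

lemma cost_nonneg: "0 \<le> cost I \<kappa> cs"
proof (induction cs rule: induct_list012)
  case (3 c c' cs)
  moreover have "0 \<le> move_cost I \<kappa> c c'"
    unfolding move_cost_def using wt_nonneg by (intro mult_nonneg_nonneg sum_nonneg) auto
  ultimately show ?case by simp
qed simp_all

lemma schedule_exists:
  assumes "set \<sigma> \<subseteq> points I"
  shows "\<exists>cs. schedule I (cnt I) \<sigma> cs"
proof -
  define d where "d r = (start I)(1 := (start I 1)(1 := r))" for r
  have "1 \<in> classes" "1 \<in> {1..cnt I 1}"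
    using nclasses_pos cnt_pos[of 1] by auto
  then have "covers I (cnt I) r (d r)" for r
    unfolding covers_def d_def by (intro bexI[of _ 1]) auto
  moreover have start: "placed I (cnt I) (start I)"
    using valid_instance unfolding wks_instance_def placed_def by blast
  then have "placed I (cnt I) (d r)" if "r \<in> points I" for r
    using that unfolding placed_def d_def by auto
  ultimately have "list_all2 (\<lambda>r c. placed I (cnt I) c \<and> covers I (cnt I) r c) \<sigma> (map d \<sigma>)"
    using assms by (induction \<sigma>) auto
  with start show ?thesis unfolding schedule_def by blast
qed

lemma opt_nonneg:
  assumes "set \<sigma> \<subseteq> points I"
  shows "0 \<le> opt I \<sigma>"
  unfolding opt_def using schedule_exists[OF assms] cost_nonneg by (intro cInf_greatest) auto

lemma le_opt:
  assumes "set \<sigma> \<subseteq> points I" "0 < q"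
    and "\<And>cs. schedule I (cnt I) \<sigma> cs \<Longrightarrow> z \<le> q * cost I (cnt I) cs"
  shows "z \<le> q * opt I \<sigma>"
proof -
  have "z / q \<le> opt I \<sigma>"
    unfolding opt_def using schedule_exists[OF assms(1)] assms(2,3)
    by (intro cInf_greatest) (auto simp: divide_le_eq mult.commute)
  then show ?thesis using assms(2) by (simp add: divide_le_eq mult.commute)
qed

end


section \<open>The algorithm and its potential\<close>

lemma sum_image_change_le:
  fixes f :: "'a \<Rightarrow> real"
  assumes "finite A" and "\<And>v. 0 \<le> f v" and le: "\<And>v. f v \<le> w"
  shows "sum f (y' ` A) \<le> sum f (y ` A) + (\<Sum>i\<in>A. w * (if y i \<noteq> y' i then 1 else 0))"
proof -
  let ?moved = "{i \<in> A. y i \<noteq> y' i}"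
  have "sum f (y' ` A) \<le> sum f (y ` A \<union> y' ` ?moved)"
    using assms by (intro sum_mono2) force+
  also have "\<dots> \<le> sum f (y ` A) + sum f (y' ` ?moved)"
    using assms by (subst sum_Un) (auto intro!: sum_nonneg)
  also have "sum f (y' ` ?moved) \<le> (\<Sum>i\<in>?moved. f (y' i))"
    using assms sum_image_le[of ?moved f y'] by (simp add: o_def)
  also have "\<dots> \<le> (\<Sum>i\<in>?moved. w)"
    by (intro sum_mono le)
  also have "\<dots> = (\<Sum>i\<in>A. w * (if y i \<noteq> y' i then 1 else 0))"
    using \<open>finite A\<close> by (intro sum.mono_neutral_cong_left) auto
  finally show ?thesis by simp
qed

type_synonym queues = "nat \<Rightarrow> nat queue"

definition layout :: "queues \<Rightarrow> config" where
  "layout S j = occupant (S j)"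

context server_instance
begin

definition slack :: "nat \<Rightarrow> queues \<Rightarrow> nat \<Rightarrow> real" where
  "slack r S j = wt I j - credit (S j) r"

definition miss :: "nat \<Rightarrow> nat \<Rightarrow> queues \<Rightarrow> queues" where
  "miss r a S = (\<lambda>j. charge r (slack r S a) (S j))(a := admit (slots a) r (S a))"

definition serves :: "nat \<Rightarrow> queues \<Rightarrow> queues \<Rightarrow> bool" where
  "serves r S S' \<longleftrightarrow>
     (if covers I slots r (layout S) then S' = S
      else \<exists>a. is_arg_min (slack r S) (\<lambda>j. j \<in> classes) a \<and> S' = miss r a S)"

definition consistent :: "queues \<Rightarrow> bool" where
  "consistent S \<longleftrightarrow> placed I slots (layout S) \<and>
     (\<forall>j\<in>classes. valid_queue (wt I j) (cnt I j) (slots j) (S j))"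

definition total_debt :: "queues \<Rightarrow> config \<Rightarrow> real" where
  "total_debt S y = (\<Sum>j\<in>classes. \<Sum>v\<in>y j ` {1..cnt I j}. debt (wt I j) (slots j) (S j) v)"

definition total_credit :: "queues \<Rightarrow> real" where
  "total_credit S = (\<Sum>j\<in>classes. \<Sum>v\<in>points I. credit (S j) v)"

definition potential :: "queues \<Rightarrow> config \<Rightarrow> real" where
  "potential S y = 2 * real (nclasses I) * total_debt S y + 2 * total_credit S"

lemma consistent_valid_queue:
  "consistent S \<Longrightarrow> j \<in> classes \<Longrightarrow> valid_queue (wt I j) (cnt I j) (slots j) (S j)"
  unfolding consistent_def by blast

lemma potential_nonneg:
  assumes "consistent S"
  shows "0 \<le> potential S y"
proof -
  have "0 \<le> total_debt S y"
    unfolding total_debt_def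
    by (intro sum_nonneg debt_nonneg[OF consistent_valid_queue[OF assms]])
  moreover have "0 \<le> total_credit S"
    unfolding total_credit_def using consistent_valid_queue[OF assms]
    by (intro sum_nonneg) (auto simp: valid_queue_def)
  ultimately show ?thesis
    by (simp add: potential_def)
qed

lemma total_debt_move:
  assumes "consistent S"
  shows "total_debt S y' \<le> total_debt S y + 2 * move_cost I (cnt I) y y'"
proof -
  have "(\<Sum>v\<in>y' j ` {1..cnt I j}. debt (wt I j) (slots j) (S j) v)
      \<le> (\<Sum>v\<in>y j ` {1..cnt I j}. debt (wt I j) (slots j) (S j) v)
        + (\<Sum>i = 1..cnt I j. wt I j * (if y j i \<noteq> y' j i then 1 else 0))"
    if "j \<in> classes" for j
    using debt_nonneg[OF consistent_valid_queue[OF assms that]]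
      debt_le_weight[OF consistent_valid_queue[OF assms that]]
    by (intro sum_image_change_le) auto
  from sum_mono[of classes, OF this] show ?thesis
    by (simp add: total_debt_def sum.distrib move_cost_def)
qed

lemma potential_move:
  assumes "consistent S"
  shows "potential S y' \<le> potential S y + 4 * real (nclasses I) * move_cost I (cnt I) y y'"
  using mult_left_mono[OF total_debt_move[OF assms], of "2 * real (nclasses I)" y' y]
  unfolding potential_def by (simp add: algebra_simps)

context
  fixes S :: queues and r a :: nat
  assumes consistent: "consistent S"
    and uncovered: "\<not> covers I slots r (layout S)"
    and cheapest: "is_arg_min (slack r S) (\<lambda>j. j \<in> classes) a"
begin

lemma cheapest_class: "a \<in> classes"
  using cheapest by (simp add: is_arg_min_def)

lemma slack_cheapest_le: "j \<in> classes \<Longrightarrow> slack r S a \<le> slack r S j"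
  using cheapest by (simp add: is_arg_min_linorder)

lemma slack_cheapest_nonneg: "0 \<le> slack r S a"
  using consistent_valid_queue[OF consistent cheapest_class]
  by (simp add: slack_def valid_queue_def)

lemma requested_point_absent: "j \<in> classes \<Longrightarrow> r \<notin> occupant (S j) ` {1..slots j}"
  using uncovered unfolding covers_def layout_def by blast

lemma consistent_miss:
  assumes "r \<in> points I"
  shows "consistent (miss r a S)"
  unfolding consistent_def
proof (intro conjI ballI)
  show "placed I slots (layout (miss r a S))"
    using consistent assms unfolding consistent_def placed_def layout_def miss_def by auto
next
  fix j assume j: "j \<in> classes"
  show "valid_queue (wt I j) (cnt I j) (slots j) (miss r a S j)"
    using consistent_valid_queue[OF consistent j] slack_cheapest_nonneg slack_cheapest_le[OF j]
    by (auto simp: miss_def slack_def intro: valid_queue_admit valid_queue_charge)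
qed

lemma covers_miss: "covers I slots r (layout (miss r a S))"
proof -
  have "oldest (S a) \<in> {1..slots a}"
    using consistent_valid_queue[OF consistent cheapest_class] unfolding valid_queue_def by blast
  then show ?thesis
    using cheapest_class unfolding covers_def
    by (intro bexI[of _ a] bexI[of _ "oldest (S a)"]) (simp_all add: layout_def miss_def)
qed

lemma sum_debt_miss_le:
  assumes j: "j \<in> classes" and Y: "finite Y" "card Y \<le> cnt I j"
  shows "(\<Sum>v\<in>Y. debt (wt I j) (slots j) (miss r a S j) v)
    \<le> (\<Sum>v\<in>Y. debt (wt I j) (slots j) (S j) v)
      + (if j = a then 3 / (4 * real (nclasses I)) * wt I a else 0)
      - (if r \<in> Y then slack r S a else 0)"
proof (cases "j = a")
  case True
  have "wt I a * ageing_rate (cnt I a) (slots a) \<le> wt I a * (3 / (4 * real (nclasses I)))"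
    unfolding slots_def using True j nclasses_pos cnt_pos wt_nonneg
    by (intro mult_left_mono ageing_rate_double) auto
  then show ?thesis
    using sum_debt_admit_le[OF consistent_valid_queue[OF consistent j] cnt_less_slots[OF j]
        requested_point_absent[OF j] Y]
    by (simp add: True miss_def slack_def mult.commute split: if_splits)
next
  case False
  then show ?thesis
    using sum_debt_charge[OF requested_point_absent[OF j] Y(1)] by (simp add: miss_def)
qed

lemma total_debt_miss_le:
  assumes "covers I (cnt I) r y"
  shows "total_debt (miss r a S) y
    \<le> total_debt S y + 3 / (4 * real (nclasses I)) * wt I a - slack r S a"
proof -
  let ?Y = "\<lambda>j. y j ` {1..cnt I j}" and ?\<theta> = "slack r S a"
  obtain b where b: "b \<in> classes" "r \<in> ?Y b"
    using assms unfolding covers_def by force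
  have "total_debt (miss r a S) y \<le> (\<Sum>j\<in>classes. (\<Sum>v\<in>?Y j. debt (wt I j) (slots j) (S j) v)
      + (if j = a then 3 / (4 * real (nclasses I)) * wt I a else 0) - (if r \<in> ?Y j then ?\<theta> else 0))"
    unfolding total_debt_def
  proof (rule sum_mono)
    fix j assume "j \<in> classes"
    moreover have "card (?Y j) \<le> cnt I j"
      using card_image_le[of "{1..cnt I j}" "y j"] by simp
    ultimately show "(\<Sum>v\<in>?Y j. debt (wt I j) (slots j) (miss r a S j) v)
        \<le> (\<Sum>v\<in>?Y j. debt (wt I j) (slots j) (S j) v)
          + (if j = a then 3 / (4 * real (nclasses I)) * wt I a else 0)
          - (if r \<in> ?Y j then ?\<theta> else 0)"
      by (intro sum_debt_miss_le) auto
  qed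
  also have "\<dots> = total_debt S y + 3 / (4 * real (nclasses I)) * wt I a
      - (\<Sum>j\<in>classes. if r \<in> ?Y j then ?\<theta> else 0)"
    using cheapest_class by (simp add: total_debt_def sum.distrib sum_subtractf)
  finally have "total_debt (miss r a S) y
      \<le> total_debt S y + 3 / (4 * real (nclasses I)) * wt I a
        - (\<Sum>j\<in>classes. if r \<in> ?Y j then ?\<theta> else 0)" .
  moreover have "?\<theta> \<le> (\<Sum>j\<in>classes. if r \<in> ?Y j then ?\<theta> else 0)"
    using member_le_sum[of b classes "\<lambda>j. if r \<in> ?Y j then ?\<theta> else 0"] b slack_cheapest_nonneg
    by auto
  ultimately show ?thesis by linarith
qed

lemma total_credit_miss:
  assumes "r \<in> points I"
  shows "total_credit (miss r a S) = total_credit S + real (nclasses I) * slack r S a - wt I a"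
proof -
  have "(\<Sum>v\<in>points I. credit (miss r a S j) v)
      = (\<Sum>v\<in>points I. credit (S j) v) + slack r S a - (if j = a then wt I a else 0)" for j
    by (simp add: miss_def slack_def sum.remove[OF finite_points assms])
  then show ?thesis
    using cheapest_class by (simp add: total_credit_def sum.distrib sum_subtractf)
qed

lemma potential_miss:
  assumes "r \<in> points I" "covers I (cnt I) r y"
  shows "potential (miss r a S) y + wt I a / 2 \<le> potential S y"
proof -
  let ?l = "real (nclasses I)"
  have "2 * ?l * total_debt (miss r a S) y
      \<le> 2 * ?l * (total_debt S y + 3 / (4 * ?l) * wt I a - slack r S a)"
    by (intro mult_left_mono total_debt_miss_le assms) simp
  also have "\<dots> = 2 * ?l * total_debt S y + 3 / 2 * wt I a - 2 * ?l * slack r S a"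
    using nclasses_pos by (simp add: field_simps)
  finally show ?thesis
    by (simp add: potential_def total_credit_miss[OF assms(1)] algebra_simps)
qed

lemma move_cost_miss: "move_cost I slots (layout S) (layout (miss r a S)) \<le> wt I a / 2"
proof -
  let ?moves = "\<lambda>j. \<Sum>i = 1..slots j.
    wt I j * (if layout S j i \<noteq> layout (miss r a S) j i then 1 else 0)"
  have "?moves j \<le> (if j = a then wt I a else 0)" if "j \<in> classes" for j
  proof -
    have "?moves j \<le> (\<Sum>i = 1..slots j. if i = oldest (S a) then if j = a then wt I a else 0 else 0)"
      using wt_nonneg[OF that] by (intro sum_mono) (auto simp: layout_def miss_def)
    also have "\<dots> \<le> (if j = a then wt I a else 0)"
      using wt_nonneg[OF that] by auto
    finally show ?thesis .
  qed
  then have "sum ?moves classes \<le> (\<Sum>j\<in>classes. if j = a then wt I a else 0)"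
    by (rule sum_mono)
  then show ?thesis
    using cheapest_class by (simp add: move_cost_def)
qed

end

lemma consistent_serves:
  "consistent S \<Longrightarrow> serves r S S' \<Longrightarrow> r \<in> points I \<Longrightarrow> consistent S'"
  using consistent_miss unfolding serves_def by (metis (no_types))

lemma covers_serves: "consistent S \<Longrightarrow> serves r S S' \<Longrightarrow> covers I slots r (layout S')"
  using covers_miss unfolding serves_def by (metis (no_types))

lemma potential_serves:
  assumes "consistent S" "serves r S S'" "r \<in> points I" "covers I (cnt I) r y"
  shows "move_cost I slots (layout S) (layout S') + potential S' y \<le> potential S y"
proof (cases "covers I slots r (layout S)")
  case True
  then show ?thesis using assms(2) by (simp add: serves_def move_cost_same)
next
  case False
  then obtain a where a: "is_arg_min (slack r S) (\<lambda>j. j \<in> classes) a" "S' = miss r a S"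
    using assms(2) unfolding serves_def by auto
  show ?thesis
    using move_cost_miss[OF assms(1) False a(1)] potential_miss[OF assms(1) False a(1) assms(3,4)]
    unfolding a(2) by simp
qed

inductive serves_all :: "queues \<Rightarrow> nat list \<Rightarrow> queues list \<Rightarrow> bool" where
  serves_Nil: "serves_all S [] []"
| serves_Cons: "serves r S S' \<Longrightarrow> serves_all S' \<sigma> Ss \<Longrightarrow> serves_all S (r # \<sigma>) (S' # Ss)"

lemma serves_all_placed_covers:
  assumes "serves_all S \<sigma> Ss" "consistent S" "set \<sigma> \<subseteq> points I"
  shows "list_all2 (\<lambda>r c. placed I slots c \<and> covers I slots r c) \<sigma> (map layout Ss)"
  using assms
proof (induction rule: serves_all.induct)
  case (serves_Cons r S S' \<sigma> Ss)
  then have "consistent S'" "covers I slots r (layout S')"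
    using consistent_serves covers_serves by auto
  with serves_Cons show ?case by (simp add: consistent_def)
qed simp

lemma cost_serves_all:
  assumes "serves_all S \<sigma> Ss" "consistent S" "set \<sigma> \<subseteq> points I" "list_all2 (covers I (cnt I)) \<sigma> ds"
  shows "cost I slots (map layout (S # Ss))
    \<le> potential S y + 4 * real (nclasses I) * cost I (cnt I) (y # ds)"
  using assms
proof (induction arbitrary: y ds rule: serves_all.induct)
  case (serves_Nil S)
  then show ?case using potential_nonneg by simp
next
  case (serves_Cons r S S' \<sigma> Ss)
  from serves_Cons.prems(3) obtain d ds' where ds: "ds = d # ds'"
    and d: "covers I (cnt I) r d" and ds': "list_all2 (covers I (cnt I)) \<sigma> ds'"
    by (auto simp: list_all2_Cons1)
  have r: "r \<in> points I"
    using serves_Cons.prems(2) by simp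
  have "cost I slots (map layout (S' # Ss))
      \<le> potential S' d + 4 * real (nclasses I) * cost I (cnt I) (d # ds')"
    using serves_Cons.prems consistent_serves[OF _ serves_Cons.hyps(1) r] ds'
    by (intro serves_Cons.IH) auto
  then show ?case
    using potential_serves[OF serves_Cons.prems(1) serves_Cons.hyps(1) r d]
      potential_move[OF serves_Cons.prems(1), of d y]
    by (simp add: ds algebra_simps)
qed

text \<open>
  Positions that belong to no server are \<open>0\<close>, as in the initial memory: an execution is compared
  with the whole array of positions.
\<close>

definition start_queues :: queues where
  "start_queues j =
     \<lparr>occupant = (\<lambda>i. if j \<notin> classes \<or> i \<notin> {1..slots j} then 0
        else if i \<le> cnt I j then start I j i else 1),
      oldest = cnt I j + 1,
      credit = (\<lambda>_. 0),
      lifetime = (\<lambda>s. if s \<le> cnt I j then slots j - cnt I j + s else 0)\<rparr>"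

lemma time_left_start:
  "j \<in> classes \<Longrightarrow> s \<le> cnt I j \<Longrightarrow> time_left (slots j) (start_queues j) s = slots j - cnt I j + s"
  using cnt_less_slots[of j] by (simp add: time_left_def start_queues_def)

lemma layout_start: "j \<in> classes \<Longrightarrow> i \<in> {1..cnt I j} \<Longrightarrow> layout start_queues j i = start I j i"
  using cnt_less_slots[of j] by (simp add: layout_def start_queues_def)

lemma consistent_start: "consistent start_queues"
  unfolding consistent_def
proof (intro conjI ballI)
  show "placed I slots (layout start_queues)"
    using valid_instance
    by (auto simp: placed_def layout_def start_queues_def wks_instance_def points_def)
  fix j assume j: "j \<in> classes"
  show "valid_queue (wt I j) (cnt I j) (slots j) (start_queues j)"
    using time_left_start[OF j] cnt_less_slots[OF j] wt_nonneg[OF j]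
    unfolding valid_queue_def by (auto simp: start_queues_def)
qed

lemma debt_start:
  assumes j: "j \<in> classes" and i: "i \<in> {1..cnt I j}"
  shows "debt (wt I j) (slots j) (start_queues j) (start I j i) = 0"
proof -
  have "lifetime (start_queues j) i = time_left (slots j) (start_queues j) i"
    "0 < lifetime (start_queues j) i" "occupant (start_queues j) i = start I j i" "i \<in> {1..slots j}"
    using i time_left_start[OF j, of i] layout_start[OF j i] cnt_less_slots[OF j]
    by (auto simp: start_queues_def layout_def)
  then have "debt (wt I j) (slots j) (start_queues j) (start I j i) \<le> 0"
    using slot_le_safety[of i "slots j" "wt I j" "start_queues j"] by (simp add: debt_def)
  then show ?thesis
    using debt_nonneg[OF consistent_valid_queue[OF consistent_start j]] by (simp add: order_antisym)
qed

lemma potential_start: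
  assumes "\<forall>j\<in>classes. \<forall>i\<in>{1..cnt I j}. y j i = start I j i"
  shows "potential start_queues y = 0"
proof -
  have "debt (wt I j) (slots j) (start_queues j) v = 0"
    if "j \<in> classes" "v \<in> y j ` {1..cnt I j}" for j v
    using that assms debt_start by auto
  then show ?thesis
    by (simp add: potential_def total_debt_def total_credit_def start_queues_def)
qed

lemma schedule_serves_all:
  assumes "serves_all start_queues \<sigma> Ss" "set \<sigma> \<subseteq> points I"
  shows "schedule I slots \<sigma> (map layout (start_queues # Ss))"
  using serves_all_placed_covers[OF assms(1) consistent_start assms(2)]
    consistent_start layout_start
  unfolding schedule_def consistent_def by auto

lemma serves_all_competitive:
  assumes "serves_all start_queues \<sigma> Ss" "set \<sigma> \<subseteq> points I"
  shows "cost I slots (map layout (start_queues # Ss)) \<le> 4 * real (nclasses I) * opt I \<sigma>"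
proof (rule le_opt[OF assms(2)])
  show "0 < 4 * real (nclasses I)"
    using nclasses_pos by simp
  fix cs assume "schedule I (cnt I) \<sigma> cs"
  then obtain y ds where cs: "cs = y # ds"
    and y: "\<forall>j\<in>classes. \<forall>i\<in>{1..cnt I j}. y j i = start I j i"
    and "list_all2 (\<lambda>r c. placed I (cnt I) c \<and> covers I (cnt I) r c) \<sigma> ds"
    unfolding schedule_def by blast
  then have "list_all2 (covers I (cnt I)) \<sigma> ds"
    by (auto elim: list_all2_mono)
  then show "cost I slots (map layout (start_queues # Ss))
      \<le> 4 * real (nclasses I) * cost I (cnt I) cs"
    using cost_serves_all[OF assms(1) consistent_start assms(2), of ds y] potential_start[OF y]
    unfolding cs by simp
qed

end


section \<open>The programs\<close>

abbreviation entry :: "string \<Rightarrow> string \<Rightarrow> nexp" where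
  "entry x i \<equiv> NCell x (register i) (NConst 0)"

abbreviation equal :: "nexp \<Rightarrow> nexp \<Rightarrow> bexp" where
  "equal a b \<equiv> BAnd (at_most a b) (at_most b a)"

text \<open>No instruction multiplies two naturals, so \<open>2 * l * k\<close> is computed by repeated addition.\<close>

definition count_slots :: com where
  "count_slots = Seq (NSet ''K'' (register ''j'') (NConst 0) (NConst 0))
     (For ''i'' (NConst 1) (register ''l'')
        (NSet ''K'' (register ''j'') (NConst 0)
           (NAdd (entry ''K'' ''j'') (NAdd (entry ''k'' ''j'') (entry ''k'' ''j'')))))"

definition fill_slots :: com where
  "fill_slots = For ''i'' (NAdd (entry ''k'' ''j'') (NConst 1)) (entry ''K'' ''j'')
     (NSet ''pos'' (register ''j'') (register ''i'') (NConst 1))"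

definition init_class :: com where
  "init_class = Seq count_slots
     (Seq (NSet ''p'' (register ''j'') (NConst 0) (NAdd (entry ''k'' ''j'') (NConst 1)))
        fill_slots)"

definition init_prog :: com where
  "init_prog = For ''j'' (NConst 1) (register ''l'') init_class"

definition scan_slots :: com where
  "scan_slots = For ''i'' (NConst 1) (entry ''K'' ''j'')
     (Cond (equal (NCell ''pos'' (register ''j'') (register ''i'')) (register ''req''))
        (assign ''f'' (NConst 1)) SKIP)"

definition scan_prog :: com where
  "scan_prog = Seq (assign ''f'' (NConst 0)) (For ''j'' (NConst 1) (register ''l'') scan_slots)"

definition slack_of :: "string \<Rightarrow> rexp" where
  "slack_of x =
     RSub (RCell ''W'' (register x) (NConst 0)) (RCell ''c'' (register x) (register ''req''))"

definition choose_prog :: com where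
  "choose_prog = Seq (assign ''a'' (NConst 1))
     (For ''j'' (NConst 1) (register ''l'')
        (Cond (RLess (slack_of ''j'') (slack_of ''a'')) (assign ''a'' (register ''j'')) SKIP))"

definition charge_prog :: com where
  "charge_prog = Seq (RSet ''t'' (NConst 0) (NConst 0) (slack_of ''a''))
     (For ''j'' (NConst 1) (register ''l'')
        (RSet ''c'' (register ''j'') (register ''req'')
           (RAdd (RCell ''c'' (register ''j'') (register ''req''))
              (RCell ''t'' (NConst 0) (NConst 0)))))"

definition admit_prog :: com where
  "admit_prog = Seq (RSet ''c'' (register ''a'') (register ''req'') (RNat (NConst 0)))
    (Seq (NSet ''pos'' (register ''a'') (entry ''p'' ''a'') (register ''req''))
         (Cond (NLess (entry ''p'' ''a'') (entry ''K'' ''a''))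
            (NSet ''p'' (register ''a'') (NConst 0) (NAdd (entry ''p'' ''a'') (NConst 1)))
            (NSet ''p'' (register ''a'') (NConst 0) (NConst 1))))"

definition miss_prog :: com where
  "miss_prog = Seq choose_prog (Seq charge_prog admit_prog)"

definition serve_prog :: com where
  "serve_prog = Seq scan_prog (Cond (NLess (register ''f'') (NConst 1)) miss_prog SKIP)"

definition same_except :: "string set \<Rightarrow> store \<Rightarrow> store \<Rightarrow> bool" where
  "same_except X s s' \<longleftrightarrow> (\<forall>x. x \<notin> X \<longrightarrow> nats s' x = nats s x \<and> reals s' x = reals s x)"

lemma same_except_refl [simp]: "same_except X s s"
  by (simp add: same_except_def)

lemma same_except_put_nat [simp]:
  "x \<in> X \<Longrightarrow> same_except X s (put_nat x i j v s') \<longleftrightarrow> same_except X s s'"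
  by (auto simp: same_except_def)

lemma same_except_put_real [simp]:
  "x \<in> X \<Longrightarrow> same_except X s (put_real x i j v s') \<longleftrightarrow> same_except X s s'"
  by (auto simp: same_except_def)

lemma runs_count_slots:
  fixes s :: store
  defines "j \<equiv> reg s ''j''"
  shows "runs count_slots (reg s ''l'' * 5 + 5) s
    (same_except {''i''} (put_nat ''K'' j 0 (2 * reg s ''l'' * nats s ''k'' j 0) s))"
  unfolding count_slots_def
proof (rule runs_Seq_NSet[OF runs_For[where lo = 1 and n = "reg s ''l''" and T = 1 and
      T' = "reg s ''l'' * 5 + 3" and
      Inv = "\<lambda>m. same_except {''i''} (put_nat ''K'' j 0 (2 * (m - 1) * nats s ''k'' j 0) s)"]],
    goal_cases counter limit body exit start init range time total_time)
  case (body m s')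
  then obtain m' where "m = Suc m'" by (cases m) auto
  with body show ?case
    by (simp add: runs_Suc same_except_def j_def algebra_simps)
qed (simp_all add: same_except_def j_def)

lemma runs_fill_slots:
  fixes s :: store
  defines "j \<equiv> reg s ''j''"
  assumes "nats s ''k'' j 0 \<le> nats s ''K'' j 0"
  shows "runs fill_slots (nats s ''K'' j 0 * 5 + 3) s
    (\<lambda>s'. same_except {''i'', ''pos''} s s' \<and>
       nats s' ''pos'' = (\<lambda>j' i. if j' = j \<and> i \<in> {nats s ''k'' j 0<..nats s ''K'' j 0} then 1
         else nats s ''pos'' j' i))"
  unfolding fill_slots_def
proof (rule runs_For[where lo = "Suc (nats s ''k'' j 0)" and T = 1 and n = "nats s ''K'' j 0" and
      Inv = "\<lambda>m s'. same_except {''i'', ''pos''} s s' \<and>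
        nats s' ''pos'' = (\<lambda>j' i. if j' = j \<and> i \<in> {nats s ''k'' j 0<..<m} then 1
          else nats s ''pos'' j' i)"],
    goal_cases counter limit body exit start init range time)
  case (body m s')
  then show ?case
    by (auto simp: runs_Suc same_except_def j_def fun_eq_iff)
qed (use assms in \<open>auto simp: same_except_def fun_eq_iff\<close>)

context server_instance
begin

definition represents :: "store \<Rightarrow> queues \<Rightarrow> bool" where
  "represents s S \<longleftrightarrow> reg s ''l'' = nclasses I \<and> nats s ''pos'' = layout S \<and>
     (\<forall>j\<in>classes. nats s ''K'' j 0 = slots j \<and> reals s ''W'' j 0 = wt I j \<and>
        nats s ''p'' j 0 = oldest (S j) \<and> reals s ''c'' j = credit (S j))"

definition init_time :: nat where
  "init_time = nclasses I * (nclasses I * 5 + 10 * inst_size I ^ 2 + 15) + 3"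

definition serve_time :: nat where
  "serve_time = nclasses I * (12 * inst_size I ^ 2 + 18) + 25"

lemma nclasses_le_size: "nclasses I \<le> inst_size I"
proof -
  have "(\<Sum>j\<in>classes. 1) \<le> (\<Sum>j\<in>classes. cnt I j)"
    using cnt_pos by (intro sum_mono) auto
  then show ?thesis by (simp add: inst_size_def)
qed

lemma slots_le_size: "j \<in> classes \<Longrightarrow> slots j \<le> 2 * inst_size I ^ 2"
proof -
  assume "j \<in> classes"
  then have "cnt I j \<le> (\<Sum>j\<in>classes. cnt I j)"
    by (intro member_le_sum) auto
  then have "cnt I j \<le> inst_size I"
    by (simp add: inst_size_def)
  then show ?thesis
    using nclasses_le_size unfolding slots_def by (simp add: power2_eq_square mult_le_mono)
qed

lemma represents_nclasses: "represents s S \<Longrightarrow> reg s ''l'' = nclasses I"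
  by (simp add: represents_def)

lemma represents_cong:
  assumes "\<And>x. x \<in> {''l'', ''K'', ''pos'', ''p''} \<Longrightarrow> nats s' x = nats s x"
    and "\<And>x. x \<in> {''W'', ''c''} \<Longrightarrow> reals s' x = reals s x"
  shows "represents s' S \<longleftrightarrow> represents s S"
  using assms by (simp add: represents_def)

lemma represents_put_nat [simp]:
  "x \<notin> {''l'', ''K'', ''pos'', ''p''} \<Longrightarrow> represents (put_nat x i j v s) S \<longleftrightarrow> represents s S"
  by (rule represents_cong) auto

lemma represents_put_real [simp]:
  "x \<notin> {''W'', ''c''} \<Longrightarrow> represents (put_real x i j v s) S \<longleftrightarrow> represents s S"
  by (rule represents_cong) auto

lemma represents_charge:
  assumes "represents s S" "j \<in> classes"
  shows "represents (put_real ''c'' j v (reals s ''c'' j v + \<theta>) s) (S(j := charge v \<theta> (S j)))"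
  using assms by (auto simp: represents_def layout_def fun_eq_iff)

lemma represents_same_except:
  assumes "represents s S" "same_except X s s'"
    "X \<inter> {''l'', ''K'', ''W'', ''pos'', ''p'', ''c''} = {}"
  shows "represents s' S"
  using assms unfolding represents_def same_except_def by auto

definition initialized :: "nat \<Rightarrow> store \<Rightarrow> bool" where
  "initialized m s \<longleftrightarrow> same_except {''K'', ''i'', ''p'', ''pos'', ''j''} (load I) s \<and>
     (\<forall>j\<in>{1..<m}. nats s ''K'' j 0 = slots j \<and> nats s ''p'' j 0 = oldest (start_queues j)) \<and>
     (\<forall>j i. nats s ''pos'' j i =
        (if j \<in> {1..<m} then occupant (start_queues j) i else nats (load I) ''pos'' j i))"

lemma initialized_Suc:
  assumes s: "initialized m s" and m: "m \<in> classes"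
    and s': "same_except {''i'', ''pos''}
      (put_nat ''p'' m 0 (cnt I m + 1) (put_nat ''K'' m 0 (slots m) s)) s'"
    and pos: "nats s' ''pos'' =
      (\<lambda>j i. if j = m \<and> i \<in> {cnt I m<..slots m} then 1 else nats s ''pos'' j i)"
  shows "initialized (Suc m) s'"
  unfolding initialized_def
proof (intro conjI allI)
  show "same_except {''K'', ''i'', ''p'', ''pos'', ''j''} (load I) s'"
    using s s' by (simp add: initialized_def same_except_def)
  show "\<forall>j\<in>{1..<Suc m}. nats s' ''K'' j 0 = slots j \<and> nats s' ''p'' j 0 = oldest (start_queues j)"
    using s s' by (auto simp: initialized_def same_except_def start_queues_def)
  fix j i
  have "nats s' ''pos'' m i = occupant (start_queues m) i"
    using s m cnt_less_slots[OF m] unfolding pos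
    by (auto simp: initialized_def start_queues_def load_def)
  moreover have "nats s' ''pos'' j i = nats s ''pos'' j i" if "j \<noteq> m"
    using that by (simp add: pos)
  ultimately show "nats s' ''pos'' j i =
      (if j \<in> {1..<Suc m} then occupant (start_queues j) i else nats (load I) ''pos'' j i)"
    using s m by (cases "j = m") (auto simp: initialized_def)
qed

lemma represents_initialized:
  assumes "initialized (Suc (nclasses I)) s"
  shows "represents s start_queues"
proof -
  have "nats s ''pos'' j i = layout start_queues j i" for j i
    using assms
    by (cases "j \<in> classes") (auto simp: initialized_def layout_def start_queues_def load_def)
  then have "nats s ''pos'' = layout start_queues"
    by blast
  then show ?thesis
    using assms by (simp add: represents_def initialized_def same_except_def load_def
        atLeastLessThanSuc_atLeastAtMost start_queues_def)
qed

lemma runs_init_class: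
  assumes s: "initialized m s" and m: "m \<in> classes" and j: "reg s ''j'' = m"
  shows "runs init_class (nclasses I * 5 + 10 * inst_size I ^ 2 + 11) s
    (\<lambda>s'. reg s' ''j'' = m \<and> initialized (Suc m) s')"
  unfolding init_class_def
proof (rule runs_Seq_trans)
  have regs: "reg s ''l'' = nclasses I" "nats s ''k'' m 0 = cnt I m"
    using s m by (simp_all add: initialized_def same_except_def load_def)
  show "runs count_slots (nclasses I * 5 + 5) s
      (same_except {''i''} (put_nat ''K'' m 0 (slots m) s))"
    using runs_count_slots[of s] by (simp add: j regs slots_def)
  fix s1 assume s1: "same_except {''i''} (put_nat ''K'' m 0 (slots m) s) s1"
  let ?s2 = "put_nat ''p'' m 0 (cnt I m + 1) s1"
  have regs1: "reg s1 ''j'' = m" "nats s1 ''k'' m 0 = cnt I m"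
    using s1 j regs by (simp_all add: same_except_def)
  have regs2: "reg ?s2 ''j'' = m" "nats ?s2 ''k'' m 0 = cnt I m" "nats ?s2 ''K'' m 0 = slots m"
    "nats ?s2 ''pos'' = nats s ''pos''"
    using s1 regs1 by (simp_all add: same_except_def)
  have "runs fill_slots (slots m * 5 + 3) ?s2
      (\<lambda>s'. same_except {''i'', ''pos''} ?s2 s' \<and> nats s' ''pos'' =
        (\<lambda>j i. if j = m \<and> i \<in> {cnt I m<..slots m} then 1 else nats s ''pos'' j i))"
    using runs_fill_slots[of ?s2] cnt_less_slots[OF m] by (simp only: regs2)
  then have "runs fill_slots (10 * inst_size I ^ 2 + 3) ?s2
      (\<lambda>s'. reg s' ''j'' = m \<and> initialized (Suc m) s')"
  proof (rule runs_mono)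
    show "slots m * 5 + 3 \<le> 10 * inst_size I ^ 2 + 3"
      using slots_le_size[OF m] by simp
    fix s' assume s': "same_except {''i'', ''pos''} ?s2 s' \<and> nats s' ''pos'' =
      (\<lambda>j i. if j = m \<and> i \<in> {cnt I m<..slots m} then 1 else nats s ''pos'' j i)"
    show "reg s' ''j'' = m \<and> initialized (Suc m) s'"
      using s1 s' regs1 by (intro conjI initialized_Suc[OF s m]) (simp_all add: same_except_def)
  qed
  then show "runs
      (Seq (NSet ''p'' (register ''j'') (NConst 0) (NAdd (entry ''k'' ''j'') (NConst 1))) fill_slots)
      (10 * inst_size I ^ 2 + 5) s1 (\<lambda>s'. reg s' ''j'' = m \<and> initialized (Suc m) s')"
    using regs1 by (intro runs_Seq_NSet[where T = "10 * inst_size I ^ 2 + 3"]) simp_all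
qed simp

lemma runs_init_prog:
  "runs init_prog init_time (load I) (\<lambda>s. represents s start_queues)"
  unfolding init_prog_def init_time_def
proof (rule runs_For[where Inv = initialized and lo = 1 and n = "nclasses I" and
      T = "nclasses I * 5 + 10 * inst_size I ^ 2 + 11"],
    goal_cases counter limit body exit start init range time)
  case (body m s)
  then show ?case
    by (intro runs_init_class) simp_all
next
  case (exit s)
  then show ?case
    by (rule represents_initialized)
qed (simp_all add: initialized_def same_except_def load_def)

lemma runs_scan_slots:
  fixes s :: store
  defines "j \<equiv> reg s ''j''"
  shows "runs scan_slots (nats s ''K'' j 0 * 6 + 3) s
    (\<lambda>s'. same_except {''f'', ''i''} s s' \<and>
       reg s' ''f'' = (if reg s ''req'' \<in> nats s ''pos'' j ` {1..nats s ''K'' j 0}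
         then 1 else reg s ''f''))"
  unfolding scan_slots_def
proof (rule runs_For[where lo = 1 and n = "nats s ''K'' j 0" and T = 2 and
      Inv = "\<lambda>m s'. same_except {''f'', ''i''} s s' \<and>
        reg s' ''f'' = (if reg s ''req'' \<in> nats s ''pos'' j ` {1..<m}
          then 1 else reg s ''f'')"],
    goal_cases counter limit body exit start init range time)
  case (body m s')
  then show ?case
    by (auto simp: runs_Suc numeral_2_eq_2 same_except_def j_def atLeastLessThanSuc)
qed (auto simp: same_except_def j_def atLeastLessThanSuc_atLeastAtMost)

lemma runs_scan_prog:
  assumes s: "represents s S"
  defines "r \<equiv> reg s ''req''"
  shows "runs scan_prog (nclasses I * (12 * inst_size I ^ 2 + 7) + 5) s
    (\<lambda>s'. same_except {''f'', ''i'', ''j''} s s' \<and>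
       reg s' ''f'' = (if covers I slots r (layout S) then 1 else 0))"
proof -
  let ?hit = "\<lambda>j. r \<in> layout S j ` {1..slots j}"
  let ?Inv = "\<lambda>m s'. same_except {''f'', ''i'', ''j''} s s' \<and>
    reg s' ''f'' = (if \<exists>j\<in>{1..<m}. ?hit j then 1 else 0)"
  have covers: "covers I slots r (layout S) \<longleftrightarrow> (\<exists>j\<in>classes. ?hit j)"
    by (auto simp: covers_def)
  show ?thesis
    unfolding scan_prog_def
  proof (rule runs_Seq_NSet[OF runs_For[where Inv = ?Inv and lo = 1 and n = "nclasses I" and
        T = "12 * inst_size I ^ 2 + 3" and T' = "nclasses I * (12 * inst_size I ^ 2 + 7) + 3"]],
      goal_cases counter limit body exit start init range time total_time)
    case (body m s1)
    then have m: "m \<in> classes" by simp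
    have s1: "nats s1 ''K'' m 0 = slots m" "nats s1 ''pos'' = layout S" "reg s1 ''req'' = r"
      "reg s1 ''j'' = m"
      using body s m by (simp_all add: same_except_def represents_def r_def)
    have "runs scan_slots (slots m * 6 + 3) s1 (\<lambda>s'. same_except {''f'', ''i''} s1 s' \<and>
        reg s' ''f'' = (if ?hit m then 1 else reg s1 ''f''))"
      using runs_scan_slots[of s1] by (simp only: s1)
    then show ?case
    proof (rule runs_mono)
      show "slots m * 6 + 3 \<le> 12 * inst_size I ^ 2 + 3"
        using slots_le_size[OF m] by simp
      fix s' assume "same_except {''f'', ''i''} s1 s' \<and>
        reg s' ''f'' = (if ?hit m then 1 else reg s1 ''f'')"
      then show "reg s' ''j'' = m \<and> ?Inv (Suc m) s'"
        using body by (simp add: same_except_def atLeastLessThanSuc)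
    qed
  next
    case (exit s')
    then show ?case
      by (simp add: covers atLeastLessThanSuc_atLeastAtMost)
  qed (simp_all add: same_except_def represents_nclasses[OF s])
qed

lemma runs_choose_prog:
  assumes s: "represents s S"
  defines "r \<equiv> reg s ''req''"
  shows "runs choose_prog (nclasses I * 6 + 5) s
    (\<lambda>s'. same_except {''a'', ''j''} s s' \<and>
       is_arg_min (slack r S) (\<lambda>j. j \<in> classes) (reg s' ''a''))"
proof -
  let ?Inv = "\<lambda>m s'. same_except {''a'', ''j''} s s' \<and> reg s' ''a'' \<in> classes \<and>
    (\<forall>j\<in>{1..<m}. slack r S (reg s' ''a'') \<le> slack r S j)"
  show ?thesis
    unfolding choose_prog_def
  proof (rule runs_Seq_NSet[OF runs_For[where Inv = ?Inv and lo = 1 and n = "nclasses I" and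
        T = 2 and T' = "nclasses I * 6 + 3"]],
      goal_cases counter limit body exit start init range time total_time)
    case (body m s')
    have "rval s' (slack_of x) = slack r S (reg s' x)" if "reg s' x \<in> classes" for x
      using that body s by (simp add: slack_of_def slack_def same_except_def represents_def r_def)
    then have "bval s' (RLess (slack_of ''j'') (slack_of ''a''))
        \<longleftrightarrow> slack r S m < slack r S (reg s' ''a'')"
      using body by simp
    moreover have "\<forall>j\<in>{1..<Suc m}. slack r S (if slack r S m < slack r S (reg s' ''a'')
        then m else reg s' ''a'') \<le> slack r S j"
      using body by (force simp: atLeastLessThanSuc)
    ultimately show ?case
      using body unfolding numeral_2_eq_2 runs_Suc
      by (cases "slack r S m < slack r S (reg s' ''a'')") (simp_all del: bval.simps)
  next
    case (exit s')
    then show ?case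
      by (auto simp: is_arg_min_linorder)
  qed (use nclasses_pos in \<open>simp_all add: same_except_def represents_nclasses[OF s]\<close>)
qed

lemma runs_charge_prog:
  assumes s: "represents s S" and a: "reg s ''a'' \<in> classes"
  defines "r \<equiv> reg s ''req''" and "\<theta> \<equiv> slack (reg s ''req'') S (reg s ''a'')"
  shows "runs charge_prog (nclasses I * 5 + 5) s
    (\<lambda>s'. same_except {''c'', ''t'', ''j''} s s' \<and> represents s' (\<lambda>j. charge r \<theta> (S j)))"
proof -
  let ?Inv = "\<lambda>m s'. same_except {''c'', ''t'', ''j''} s s' \<and> reals s' ''t'' 0 0 = \<theta> \<and>
    represents s' (\<lambda>j. if j \<in> {1..<m} then charge r \<theta> (S j) else S j)"
  have \<theta>: "rval s (slack_of ''a'') = \<theta>"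
    using s a by (simp add: slack_of_def slack_def represents_def \<theta>_def)
  show ?thesis
    unfolding charge_prog_def
  proof (rule runs_Seq_RSet[OF runs_For[where Inv = ?Inv and lo = 1 and n = "nclasses I" and
        T = 1 and T' = "nclasses I * 5 + 3"]],
      goal_cases counter limit body exit start init range time total_time)
    case (body m s')
    let ?S = "\<lambda>m j. if j \<in> {1..<m} then charge r \<theta> (S j) else S j"
    have "represents (put_real ''c'' m r (reals s' ''c'' m r + \<theta>) s')
        ((?S m)(m := charge r \<theta> (?S m m)))"
      using body by (intro represents_charge) simp_all
    moreover have "(?S m)(m := charge r \<theta> (?S m m)) = ?S (Suc m)"
      using body by (auto simp: fun_eq_iff)
    moreover have "reg s' ''req'' = r"
      using body by (simp add: same_except_def r_def)
    ultimately show ?case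
      using body by (simp add: runs_Suc)
  next
    case (exit s')
    then have "represents s'
        (\<lambda>j. if j \<in> {1..<Suc (nclasses I)} then charge r \<theta> (S j) else S j)"
      by blast
    then have "represents s' (\<lambda>j. charge r \<theta> (S j))"
      by (simp add: represents_def layout_def fun_eq_iff)
    then show ?case
      using exit by simp
  next
    case (limit m s')
    then show ?case by (auto dest: represents_nclasses)
  next
    case init
    then show ?case using s by (simp add: \<theta>)
  qed simp_all
qed

lemma runs_admit_prog:
  assumes s: "represents s S"
  defines "r \<equiv> reg s ''req''" and "a \<equiv> reg s ''a''"
  assumes a: "a \<in> classes"
  shows "runs admit_prog 6 s (\<lambda>s'. represents s' (S(a := admit (slots a) r (S a))))"
proof -
  have "nats s ''K'' a 0 = slots a" "nats s ''p'' a 0 = oldest (S a)"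
    using s a by (simp_all add: represents_def)
  then show ?thesis
    using s a unfolding admit_prog_def r_def a_def
    by (auto simp: runs_Suc eval_nat_numeral represents_def layout_def fun_eq_iff)
qed

lemma runs_miss_prog:
  assumes s: "represents s S"
  defines "r \<equiv> reg s ''req''"
  assumes uncovered: "\<not> covers I slots r (layout S)"
  shows "runs miss_prog (nclasses I * 11 + 18) s (\<lambda>s'. \<exists>S'. serves r S S' \<and> represents s' S')"
  unfolding miss_prog_def
proof (rule runs_Seq_trans[OF runs_choose_prog[OF s]])
  fix s1 assume s1: "same_except {''a'', ''j''} s s1 \<and>
    is_arg_min (slack (reg s ''req'') S) (\<lambda>j. j \<in> classes) (reg s1 ''a'')"
  define a where "a = reg s1 ''a''"
  have a: "is_arg_min (slack r S) (\<lambda>j. j \<in> classes) a" "a \<in> classes"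
    using s1 by (simp_all add: a_def r_def is_arg_min_def)
  have rep1: "represents s1 S" and r: "reg s1 ''req'' = r"
    using represents_same_except[OF s, of "{''a'', ''j''}" s1] s1
    by (simp_all add: same_except_def r_def)
  show "runs (Seq charge_prog admit_prog) (nclasses I * 5 + 12) s1
      (\<lambda>s'. \<exists>S'. serves r S S' \<and> represents s' S')"
  proof (rule runs_Seq_trans[OF runs_charge_prog[OF rep1]])
    show "reg s1 ''a'' \<in> classes"
      using a by (simp add: a_def)
    fix s2 assume s2: "same_except {''c'', ''t'', ''j''} s1 s2 \<and> represents s2 (\<lambda>j.
        charge (reg s1 ''req'') (slack (reg s1 ''req'') S (reg s1 ''a'')) (S j))"
    then have rep2: "represents s2 (\<lambda>j. charge r (slack r S a) (S j))"
      and regs: "reg s2 ''req'' = r" "reg s2 ''a'' = a"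
      using r by (simp_all add: same_except_def a_def)
    have "runs admit_prog 6 s2 (\<lambda>s'. represents s' (miss r a S))"
      using runs_admit_prog[OF rep2] a(2) by (simp add: regs miss_def)
    then show "runs admit_prog 6 s2 (\<lambda>s'. \<exists>S'. serves r S S' \<and> represents s' S')"
      by (rule runs_mono) (use a(1) uncovered in \<open>auto simp: serves_def\<close>)
  qed simp
qed simp

lemma runs_serve_prog:
  assumes s: "represents s S"
  defines "r \<equiv> reg s ''req''"
  shows "runs serve_prog serve_time s
    (\<lambda>s'. \<exists>S'. serves r S S' \<and> represents s' S')"
  unfolding serve_prog_def serve_time_def
proof (rule runs_Seq_trans[OF runs_scan_prog[OF s]])
  fix s1 assume s1: "same_except {''f'', ''i'', ''j''} s s1 \<and>
    reg s1 ''f'' = (if covers I slots (reg s ''req'') (layout S) then 1 else 0)"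
  have rep: "represents s1 S" and r: "reg s1 ''req'' = r"
    using represents_same_except[OF s, of "{''f'', ''i'', ''j''}" s1] s1
    by (simp_all add: same_except_def r_def)
  show "runs (Cond (NLess (register ''f'') (NConst 1)) miss_prog SKIP)
      (Suc (nclasses I * 11 + 18)) s1
      (\<lambda>s'. \<exists>S'. serves r S S' \<and> represents s' S')"
    unfolding runs_Suc
    using s1 rep runs_miss_prog[OF rep] by (auto simp: r r_def serves_def split: if_splits)
qed (simp add: algebra_simps)

end


section \<open>Competitiveness\<close>

context server_instance
begin

lemma serve_refines:
  assumes B: "\<And>t. 1 \<le> t \<Longrightarrow> serve_time \<le> B t"
    and "represents s S" "1 \<le> t" "ms \<in> set_pmf (serve serve_prog B \<sigma> t s)"
  shows "all_halted ms \<and> (\<exists>Ss. serves_all S \<sigma> Ss \<and> map config_of ms = map layout Ss)"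
  using assms(2-)
proof (induction \<sigma> arbitrary: s S t ms)
  case Nil
  then show ?case by (auto simp: all_halted_def intro: serves_Nil)
next
  case (Cons r \<sigma>)
  let ?s = "put_nat ''req'' 0 0 r s"
  from Cons.prems(3) obtain m ms' where ms: "ms = m # ms'"
    and m: "m \<in> set_pmf (steps (B t) (serve_prog, ?s))"
    and ms': "ms' \<in> set_pmf (serve serve_prog B \<sigma> (Suc t) (snd m))"
    by auto
  have "runs serve_prog (B t) ?s (\<lambda>s'. \<exists>S'. serves r S S' \<and> represents s' S')"
    using runs_mono[OF runs_serve_prog[of ?s S] B[OF Cons.prems(2)]] Cons.prems(1) by simp
  then obtain S' where halted: "fst m = SKIP" and S': "serves r S S'" "represents (snd m) S'"
    using m unfolding runs_def by auto
  obtain Ss where "all_halted ms'" "serves_all S' \<sigma> Ss" "map config_of ms' = map layout Ss"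
    using Cons.IH[OF S'(2) _ ms'] by auto
  moreover have "config_of m = layout S'"
    using S'(2) by (simp add: config_of_def represents_def)
  ultimately show ?case
    using halted S'(1) by (auto simp: ms all_halted_def intro!: exI[of _ "S' # Ss"] serves_Cons)
qed

lemma play_refines:
  assumes B0: "init_time \<le> B 0"
    and B: "\<And>t. 1 \<le> t \<Longrightarrow> serve_time \<le> B t"
    and play: "ms \<in> set_pmf (play (init_prog, serve_prog) B I \<sigma>)"
  obtains Ss where "all_halted ms" "serves_all start_queues \<sigma> Ss"
    "map config_of ms = map layout (start_queues # Ss)"
proof -
  from play obtain m ms' where ms: "ms = m # ms'"
    and m: "m \<in> set_pmf (steps (B 0) (init_prog, load I))"
    and ms': "ms' \<in> set_pmf (serve serve_prog B \<sigma> 1 (snd m))"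
    by (auto simp: play_def)
  have "runs init_prog (B 0) (load I) (\<lambda>s. represents s start_queues)"
    by (rule runs_mono[OF runs_init_prog B0])
  then have halted: "fst m = SKIP" and start: "represents (snd m) start_queues"
    using m unfolding runs_def by auto
  obtain Ss where "all_halted ms'" "serves_all start_queues \<sigma> Ss"
    "map config_of ms' = map layout Ss"
    using serve_refines[OF B start order_refl ms'] by auto
  moreover have "config_of m = layout start_queues"
    using start by (simp add: config_of_def represents_def)
  ultimately show thesis
    using halted that by (simp add: ms all_halted_def)
qed

lemma time_bounds:
  "init_time \<le> 55 * (inst_size I + t) ^ 3"
  "serve_time \<le> 55 * (inst_size I + t) ^ 3"
proof -
  let ?N = "inst_size I"
  have N: "1 \<le> ?N" "nclasses I \<le> ?N"
    using nclasses_pos nclasses_le_size by simp_all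
  then have sq: "?N \<le> ?N ^ 2" "1 \<le> ?N ^ 2" and cube: "1 \<le> ?N ^ 3" "?N * ?N ^ 2 = ?N ^ 3"
    by (auto simp: power2_eq_square power3_eq_cube)
  have "nclasses I * (nclasses I * 5 + 10 * ?N ^ 2 + 15) \<le> ?N * (?N ^ 2 * 30)"
    "nclasses I * (12 * ?N ^ 2 + 18) \<le> ?N * (?N ^ 2 * 30)"
    using N sq by (intro mult_le_mono; linarith)+
  moreover have "?N ^ 3 \<le> (?N + t) ^ 3"
    by (intro power_mono) auto
  ultimately show "init_time \<le> 55 * (?N + t) ^ 3" "serve_time \<le> 55 * (?N + t) ^ 3"
    using cube unfolding init_time_def serve_time_def mult.assoc[symmetric, of ?N] by linarith+
qed

lemma play_competitive:
  assumes "ms \<in> set_pmf (play (init_prog, serve_prog) (\<lambda>t. 55 * (inst_size I + t) ^ 3) I \<sigma>)"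
    and "set \<sigma> \<subseteq> points I"
  shows "all_halted ms" "schedule I slots \<sigma> (map config_of ms)"
    "cost I slots (map config_of ms) \<le> 4 * real (nclasses I) * opt I \<sigma>"
proof -
  obtain Ss where Ss: "all_halted ms" "serves_all start_queues \<sigma> Ss"
    "map config_of ms = map layout (start_queues # Ss)"
    by (rule play_refines[OF _ _ assms(1)]) (use time_bounds(1)[of 0] time_bounds(2) in simp_all)
  show "all_halted ms" "schedule I slots \<sigma> (map config_of ms)"
    "cost I slots (map config_of ms) \<le> 4 * real (nclasses I) * opt I \<sigma>"
    using Ss(1) schedule_serves_all[OF Ss(2) assms(2)] serves_all_competitive[OF Ss(2) assms(2)]
    unfolding Ss(3) by simp_all
qed

end

lemma expectation_pmf_le_const:
  fixes f :: "'a \<Rightarrow> real"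
  assumes "0 \<le> b" "\<And>x. x \<in> set_pmf p \<Longrightarrow> f x \<le> b"
  shows "measure_pmf.expectation p f \<le> b"
proof (cases "integrable (measure_pmf p) f")
  case True
  then show ?thesis
    using assms(2) by (intro measure_pmf.integral_le_const) (simp_all add: AE_measure_pmf_iff)
next
  case False
  then show ?thesis
    using assms(1) by (simp add: not_integrable_integral_eq)
qed

theorem theorem1p4:
  shows "\<exists>(A :: online_alg) (p :: nat poly) (f :: nat \<Rightarrow> real).
    f \<in> O(\<lambda>l. real l ^ 2 * ln (real l)) \<and>
    (\<forall>(I :: wks) (\<sigma> :: nat list).
       wks_instance I \<longrightarrow> set \<sigma> \<subseteq> points I \<longrightarrow>
       (let \<kappa> = (\<lambda>j. 2 * nclasses I * cnt I j);
            B = (\<lambda>t. poly p (inst_size I + t))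
        in (\<forall>ms \<in> set_pmf (play A B I \<sigma>).
              all_halted ms \<and> schedule I \<kappa> \<sigma> (map config_of ms)) \<and>
           expected_cost A B I \<kappa> \<sigma> \<le> f (nclasses I) * opt I \<sigma>))"
proof (rule exI[of _ "(init_prog, serve_prog)"], rule exI[of _ "monom 55 3"],
    rule exI[of _ "\<lambda>l. 4 * real l"], intro conjI allI impI)
  show "(\<lambda>l. 4 * real l) \<in> O(\<lambda>l. real l ^ 2 * ln (real l))"
    by real_asymp
next
  fix I :: wks and \<sigma> :: "nat list"
  assume "wks_instance I" and \<sigma>: "set \<sigma> \<subseteq> points I"
  then interpret server_instance I
    by unfold_locales
  let ?B = "\<lambda>t. poly (monom 55 3) (inst_size I + t)"
  have B: "?B = (\<lambda>t. 55 * (inst_size I + t) ^ 3)"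
    by (simp add: poly_monom)
  note competitive = play_competitive[OF _ \<sigma>]
  have "expected_cost (init_prog, serve_prog) ?B I slots \<sigma> \<le> 4 * real (nclasses I) * opt I \<sigma>"
    unfolding expected_cost_def B using opt_nonneg[OF \<sigma>] competitive(3)
    by (intro expectation_pmf_le_const) auto
  moreover have "(\<lambda>j. 2 * nclasses I * cnt I j) = slots"
    by (simp add: slots_def fun_eq_iff)
  ultimately show "let \<kappa> = (\<lambda>j. 2 * nclasses I * cnt I j);
            B = (\<lambda>t. poly (monom 55 3) (inst_size I + t))
        in (\<forall>ms \<in> set_pmf (play (init_prog, serve_prog) B I \<sigma>).
              all_halted ms \<and> schedule I \<kappa> \<sigma> (map config_of ms)) \<and>
           expected_cost (init_prog, serve_prog) B I \<kappa> \<sigma> \<le> 4 * real (nclasses I) * opt I \<sigma>"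
    using competitive(1,2) unfolding Let_def B by simp
qed

end
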